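(* Let $\Lambda$ be a $1$-graph. Then $i_\Lambda:\Lambda\to\Pi(\Lambda)$ is injective.
   Context: A $1$-graph is a small category $\Lambda$ (identified with its set of morphisms) with a functor $d:\Lambda\to\mathbb{N}$ satisfying the factorisation property: if $d(\lambda)=m+n$ there are unique $\mu,\nu\in\Lambda$ with $d(\mu)=m$, $d(\nu)=n$, $\lambda=\mu\nu$ (equivalently, $\Lambda$ is the path category of a directed graph with $d$ the length function). $\Lambda^0=d^{-1}(0)$ is the set of identity morphisms. The fundamental groupoid of $\Lambda$ is a groupoid $\Pi(\Lambda)$ with a functor $i=i_\Lambda:\Lambda\to\Pi(\Lambda)$, $i(\Lambda^0)=\Pi(\Lambda)^0$, such that every functor $F$ from $\Lambda$ to a groupoid $\mathcal G$ is $\tilde F\circ i$ for a unique groupoid homomorphism $\tilde F:\Pi(\Lambda)\to\mathcal G$. *)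

theory Defs
  imports "HOL-Library.FuncSet"
begin

section \<open>Categories, functors, groupoids\<close>

text \<open>Small categories are single-sorted: a category is identified with its set of morphisms,
  and an object is identified with its identity morphism. As usual for higher-rank graphs,
  the composite \<open>Comp C f g\<close> is defined when the source of \<open>f\<close> is the range of \<open>g\<close>.
  The values of the operations outside \<open>Mor C\<close> are irrelevant.\<close>

record 'a cat =
  Mor :: "'a set"
  Src :: "'a \<Rightarrow> 'a"
  Rng :: "'a \<Rightarrow> 'a"
  Comp :: "'a \<Rightarrow> 'a \<Rightarrow> 'a"

locale category =
  fixes C :: "'a cat"
  assumes src_mor: "f \<in> Mor C \<Longrightarrow> Src C f \<in> Mor C"
    and rng_mor: "f \<in> Mor C \<Longrightarrow> Rng C f \<in> Mor C"
    and src_src: "f \<in> Mor C \<Longrightarrow> Src C (Src C f) = Src C f"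
    and rng_src: "f \<in> Mor C \<Longrightarrow> Rng C (Src C f) = Src C f"
    and src_rng: "f \<in> Mor C \<Longrightarrow> Src C (Rng C f) = Rng C f"
    and rng_rng: "f \<in> Mor C \<Longrightarrow> Rng C (Rng C f) = Rng C f"
    and comp_mor: "\<lbrakk>f \<in> Mor C; g \<in> Mor C; Src C f = Rng C g\<rbrakk> \<Longrightarrow> Comp C f g \<in> Mor C"
    and src_comp: "\<lbrakk>f \<in> Mor C; g \<in> Mor C; Src C f = Rng C g\<rbrakk> \<Longrightarrow> Src C (Comp C f g) = Src C g"
    and rng_comp: "\<lbrakk>f \<in> Mor C; g \<in> Mor C; Src C f = Rng C g\<rbrakk> \<Longrightarrow> Rng C (Comp C f g) = Rng C f"
    and comp_src: "f \<in> Mor C \<Longrightarrow> Comp C f (Src C f) = f"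
    and rng_comp_id: "f \<in> Mor C \<Longrightarrow> Comp C (Rng C f) f = f"
    and comp_assoc: "\<lbrakk>f \<in> Mor C; g \<in> Mor C; h \<in> Mor C; Src C f = Rng C g; Src C g = Rng C h\<rbrakk>
      \<Longrightarrow> Comp C (Comp C f g) h = Comp C f (Comp C g h)"

definition Obj :: "'a cat \<Rightarrow> 'a set" where
  "Obj C = {v \<in> Mor C. Src C v = v \<and> Rng C v = v}"

definition is_functor :: "'a cat \<Rightarrow> 'b cat \<Rightarrow> ('a \<Rightarrow> 'b) \<Rightarrow> bool" where
  "is_functor C D F \<longleftrightarrow>
     (\<forall>f \<in> Mor C. F f \<in> Mor D \<and> F (Src C f) = Src D (F f) \<and> F (Rng C f) = Rng D (F f)) \<and>
     (\<forall>f \<in> Mor C. \<forall>g \<in> Mor C. Src C f = Rng C g \<longrightarrow> F (Comp C f g) = Comp D (F f) (F g))"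

locale groupoid = category G for G :: "'g cat" +
  assumes inverse_ex: "f \<in> Mor G \<Longrightarrow> \<exists>g \<in> Mor G. Src G g = Rng G f \<and> Rng G g = Src G f \<and>
     Comp G f g = Rng G f \<and> Comp G g f = Src G f"

section \<open>1-graphs\<close>

text \<open>The first two assumptions on \<open>d\<close> say that it is a functor into the monoid of natural
  numbers, viewed as a category with one object.\<close>

locale one_graph = category \<Lambda> for \<Lambda> :: "'a cat" +
  fixes d :: "'a \<Rightarrow> nat"
  assumes degree_obj: "v \<in> Obj \<Lambda> \<Longrightarrow> d v = 0"
    and degree_comp: "\<lbrakk>f \<in> Mor \<Lambda>; g \<in> Mor \<Lambda>; Src \<Lambda> f = Rng \<Lambda> g\<rbrakk>
      \<Longrightarrow> d (Comp \<Lambda> f g) = d f + d g"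
    and factorisation: "\<lbrakk>f \<in> Mor \<Lambda>; d f = m + n\<rbrakk>
      \<Longrightarrow> \<exists>!(\<mu>, \<nu>). \<mu> \<in> Mor \<Lambda> \<and> \<nu> \<in> Mor \<Lambda> \<and> d \<mu> = m \<and> d \<nu> = n \<and>
            Src \<Lambda> \<mu> = Rng \<Lambda> \<nu> \<and> f = Comp \<Lambda> \<mu> \<nu>"

section \<open>The fundamental groupoid\<close>

text \<open>Every functor from \<open>C\<close> to a groupoid with morphisms of type \<open>'g\<close> factors uniquely
  through \<open>i\<close>. Extensionality only fixes the irrelevant values of \<open>H\<close> outside \<open>Mor P\<close>.\<close>

definition universal_for :: "'g itself \<Rightarrow> 'a cat \<Rightarrow> 'p cat \<Rightarrow> ('a \<Rightarrow> 'p) \<Rightarrow> bool" where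
  "universal_for T C P i \<longleftrightarrow>
     (\<forall>(G :: 'g cat) F. groupoid G \<and> is_functor C G F \<longrightarrow>
        (\<exists>!H. H \<in> extensional (Mor P) \<and> is_functor P G H \<and> (\<forall>x \<in> Mor C. H (i x) = F x)))"

text \<open>A HOL formula cannot quantify over all types \<open>'g\<close>. The definition therefore asks for
  universality with respect to groupoids living in the type of \<open>P\<close> itself and in a type
  large enough to hold the groupoid of equivalence classes of zigzags in \<open>C\<close>. The lemma
  \<open>fundamental_groupoid_universal\<close> shows that this implies universality with
  respect to groupoids of every type, and \<open>fundamental_groupoid_exists\<close> that a fundamental
  groupoid always exists.\<close>

definition fundamental_groupoid :: "'a cat \<Rightarrow> 'p cat \<Rightarrow> ('a \<Rightarrow> 'p) \<Rightarrow> bool" where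
  "fundamental_groupoid C P i \<longleftrightarrow>
     groupoid P \<and> is_functor C P i \<and> i ` Obj C = Obj P \<and>
     universal_for TYPE('p) C P i \<and> universal_for TYPE(('a \<times> bool) list set) C P i"

subsection \<open>Adequacy of the definition\<close>

lemma (in category) obj_src: "f \<in> Mor C \<Longrightarrow> Src C f \<in> Obj C"
  by (simp add: Obj_def src_mor src_src rng_src)

lemma (in category) obj_rng: "f \<in> Mor C \<Longrightarrow> Rng C f \<in> Obj C"
  by (simp add: Obj_def rng_mor src_rng rng_rng)

lemma (in groupoid) inverse_unique:
  assumes "f \<in> Mor G" "g \<in> Mor G" "h \<in> Mor G"
    and "Src G g = Rng G f" "Rng G g = Src G f" "Comp G g f = Src G f"
    and "Src G h = Rng G f" "Rng G h = Src G f" "Comp G f h = Rng G f"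
  shows "g = h"
proof -
  have "g = Comp G g (Comp G f h)" using assms comp_src[of g] by simp
  also have "\<dots> = Comp G (Comp G g f) h"
    using assms by (intro comp_assoc[symmetric]) auto
  also have "\<dots> = h" using assms rng_comp_id[of h] by simp
  finally show ?thesis .
qed

definition ginv :: "'g cat \<Rightarrow> 'g \<Rightarrow> 'g" where
  "ginv G f = (SOME g. g \<in> Mor G \<and> Src G g = Rng G f \<and> Rng G g = Src G f \<and>
     Comp G f g = Rng G f \<and> Comp G g f = Src G f)"

lemma (in groupoid) ginv:
  assumes "f \<in> Mor G"
  shows "ginv G f \<in> Mor G" "Src G (ginv G f) = Rng G f" "Rng G (ginv G f) = Src G f"
    "Comp G f (ginv G f) = Rng G f" "Comp G (ginv G f) f = Src G f"
proof -
  have "\<exists>g. g \<in> Mor G \<and> Src G g = Rng G f \<and> Rng G g = Src G f \<and>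
     Comp G f g = Rng G f \<and> Comp G g f = Src G f" using inverse_ex[OF assms] by blast
  from someI_ex[OF this, folded ginv_def]
  show "ginv G f \<in> Mor G" "Src G (ginv G f) = Rng G f" "Rng G (ginv G f) = Src G f"
    "Comp G f (ginv G f) = Rng G f" "Comp G (ginv G f) f = Src G f" by auto
qed

lemma is_functor_comp:
  assumes "is_functor C D F" "is_functor D E H"
  shows "is_functor C E (\<lambda>x. H (F x))"
  using assms unfolding is_functor_def by metis

lemma (in category) is_functor_cong:
  assumes "is_functor C D F" "\<And>x. x \<in> Mor C \<Longrightarrow> H x = F x"
  shows "is_functor C D H"
  using assms src_mor rng_mor comp_mor unfolding is_functor_def by simp

text \<open>A zigzag is a nonempty list of composable formal letters: \<open>(f, True)\<close> stands for \<open>f\<close> and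
  \<open>(f, False)\<close> for the formal inverse of \<open>f\<close>.\<close>

definition lsrc :: "'a cat \<Rightarrow> 'a \<times> bool \<Rightarrow> 'a" where
  "lsrc C l = (if snd l then Src C (fst l) else Rng C (fst l))"

definition lrng :: "'a cat \<Rightarrow> 'a \<times> bool \<Rightarrow> 'a" where
  "lrng C l = (if snd l then Rng C (fst l) else Src C (fst l))"

definition zsrc :: "'a cat \<Rightarrow> ('a \<times> bool) list \<Rightarrow> 'a" where
  "zsrc C w = lsrc C (last w)"

definition zrng :: "'a cat \<Rightarrow> ('a \<times> bool) list \<Rightarrow> 'a" where
  "zrng C w = lrng C (hd w)"

fun zigzag :: "'a cat \<Rightarrow> ('a \<times> bool) list \<Rightarrow> bool" where
  "zigzag C [] = False"
| "zigzag C [l] = (fst l \<in> Mor C)"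
| "zigzag C (l # m # w) = (fst l \<in> Mor C \<and> lsrc C l = lrng C m \<and> zigzag C (m # w))"

inductive zeq :: "'a cat \<Rightarrow> ('a \<times> bool) list \<Rightarrow> ('a \<times> bool) list \<Rightarrow> bool" for C where
  refl: "zigzag C w \<Longrightarrow> zeq C w w"
| sym: "zeq C u v \<Longrightarrow> zeq C v u"
| trans: "zeq C u v \<Longrightarrow> zeq C v w \<Longrightarrow> zeq C u w"
| append: "zeq C u u' \<Longrightarrow> zeq C v v' \<Longrightarrow> zsrc C u = zrng C v \<Longrightarrow> zeq C (u @ v) (u' @ v')"
| comp: "f \<in> Mor C \<Longrightarrow> g \<in> Mor C \<Longrightarrow> Src C f = Rng C g \<Longrightarrow>
    zeq C [(f, True), (g, True)] [(Comp C f g, True)]"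
| right_inv: "f \<in> Mor C \<Longrightarrow> zeq C [(f, True), (f, False)] [(Rng C f, True)]"
| left_inv: "f \<in> Mor C \<Longrightarrow> zeq C [(f, False), (f, True)] [(Src C f, True)]"
| inv_id: "f \<in> Mor C \<Longrightarrow> zeq C [(f, False), (Rng C f, True)] [(f, False)]"
| id_inv: "f \<in> Mor C \<Longrightarrow> zeq C [(Src C f, True), (f, False)] [(f, False)]"

definition zcls :: "'a cat \<Rightarrow> ('a \<times> bool) list \<Rightarrow> ('a \<times> bool) list set" where
  "zcls C w = {w'. zeq C w w'}"

definition zrep :: "('a \<times> bool) list set \<Rightarrow> ('a \<times> bool) list" where
  "zrep X = (SOME w. w \<in> X)"

definition zgroupoid :: "'a cat \<Rightarrow> ('a \<times> bool) list set cat" where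
  "zgroupoid C = \<lparr>Mor = zcls C ` {w. zigzag C w},
     Src = (\<lambda>X. zcls C [(zsrc C (zrep X), True)]),
     Rng = (\<lambda>X. zcls C [(zrng C (zrep X), True)]),
     Comp = (\<lambda>X Y. zcls C (zrep X @ zrep Y))\<rparr>"

definition zincl :: "'a cat \<Rightarrow> 'a \<Rightarrow> ('a \<times> bool) list set" where
  "zincl C f = zcls C [(f, True)]"

lemma zigzag_nonempty: "zigzag C w \<Longrightarrow> w \<noteq> []"
  by (cases w) auto

lemma zigzag_append:
  assumes "u \<noteq> []" "v \<noteq> []"
  shows "zigzag C (u @ v) \<longleftrightarrow> zigzag C u \<and> zigzag C v \<and> zsrc C u = zrng C v"
  using assms
proof (induction u)
  case (Cons l u)
  show ?case
  proof (cases u)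
    case Nil
    with Cons.prems show ?thesis by (cases v) (auto simp: zsrc_def zrng_def)
  next
    case (Cons m u')
    with Cons.IH Cons.prems show ?thesis by (auto simp: zsrc_def)
  qed
qed simp

lemma zsrc_append: "v \<noteq> [] \<Longrightarrow> zsrc C (u @ v) = zsrc C v"
  by (simp add: zsrc_def)

lemma zrng_append: "u \<noteq> [] \<Longrightarrow> zrng C (u @ v) = zrng C u"
  by (simp add: zrng_def)

lemma zigzag_Cons:
  "zigzag C (l # w) \<longleftrightarrow> fst l \<in> Mor C \<and> (w = [] \<or> (lsrc C l = zrng C w \<and> zigzag C w))"
  by (cases w) (auto simp: zrng_def)

context category
begin

lemma zeq_ends:
  "zeq C u v \<Longrightarrow> zigzag C u \<and> zigzag C v \<and> zsrc C u = zsrc C v \<and> zrng C u = zrng C v"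
proof (induction rule: zeq.induct)
  case (append u u' v v')
  then have "u \<noteq> []" "v \<noteq> []" "u' \<noteq> []" "v' \<noteq> []" using zigzag_nonempty by auto
  with append show ?case by (simp add: zigzag_append zsrc_append zrng_append)
qed (auto simp: zsrc_def zrng_def lsrc_def lrng_def src_mor rng_mor src_src rng_src src_rng
    rng_rng comp_mor src_comp rng_comp)

lemma zcls_eq: "zigzag C u \<Longrightarrow> zcls C u = zcls C v \<longleftrightarrow> zeq C u v"
  unfolding zcls_def by (auto intro: zeq.refl zeq.sym zeq.trans)

lemma zeq_zcls: "zeq C u v \<Longrightarrow> zcls C u = zcls C v"
  using zcls_eq zeq_ends by blast

lemma zrep: "zigzag C w \<Longrightarrow> zeq C w (zrep (zcls C w))"
  unfolding zrep_def zcls_def by (metis mem_Collect_eq someI_ex zeq.refl)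

lemma zends_mor: "zigzag C w \<Longrightarrow> zsrc C w \<in> Obj C \<and> zrng C w \<in> Obj C"
proof -
  assume z: "zigzag C w"
  then have "set (map fst w) \<subseteq> Mor C" by (induction C w rule: zigzag.induct) auto
  moreover have "last w \<in> set w" "hd w \<in> set w" using zigzag_nonempty[OF z] by auto
  ultimately show ?thesis
    by (auto simp: zsrc_def zrng_def lsrc_def lrng_def intro!: obj_src obj_rng)
qed

lemma zsrc_single: "zsrc C [(f, b)] = (if b then Src C f else Rng C f)"
  and zrng_single: "zrng C [(f, b)] = (if b then Rng C f else Src C f)"
  by (auto simp: zsrc_def zrng_def lsrc_def lrng_def)

lemma zg_src: "zigzag C w \<Longrightarrow> Src (zgroupoid C) (zcls C w) = zcls C [(zsrc C w, True)]"
  using zeq_ends[OF zrep] by (simp add: zgroupoid_def)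

lemma zg_rng: "zigzag C w \<Longrightarrow> Rng (zgroupoid C) (zcls C w) = zcls C [(zrng C w, True)]"
  using zeq_ends[OF zrep] by (simp add: zgroupoid_def)

lemma zg_comp:
  assumes "zigzag C u" "zigzag C v" "zsrc C u = zrng C v"
  shows "Comp (zgroupoid C) (zcls C u) (zcls C v) = zcls C (u @ v)"
proof -
  have "zeq C (u @ v) (zrep (zcls C u) @ zrep (zcls C v))"
    using assms by (intro zeq.append zrep)
  then have "zcls C (u @ v) = zcls C (zrep (zcls C u) @ zrep (zcls C v))"
    by (rule zeq_zcls)
  then show ?thesis by (simp add: zgroupoid_def)
qed

lemma zcls_obj_eq:
  assumes "a \<in> Obj C" "b \<in> Obj C"
  shows "zcls C [(a, True)] = zcls C [(b, True)] \<longleftrightarrow> a = b"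
proof
  assume "zcls C [(a, True)] = zcls C [(b, True)]"
  then have "zeq C [(a, True)] [(b, True)]" using assms zcls_eq by (simp add: Obj_def)
  then show "a = b" using zeq_ends assms by (fastforce simp: zsrc_single Obj_def)
qed simp

lemma zg_composable:
  assumes "zigzag C u" "zigzag C v"
  shows "Src (zgroupoid C) (zcls C u) = Rng (zgroupoid C) (zcls C v) \<longleftrightarrow> zsrc C u = zrng C v"
  using assms by (simp add: zg_src zg_rng zcls_obj_eq zends_mor)

lemma zg_mor: "zcls C w \<in> Mor (zgroupoid C)" if "zigzag C w"
  using that by (simp add: zgroupoid_def)

lemma zg_mor_cases:
  assumes "X \<in> Mor (zgroupoid C)"
  obtains w where "zigzag C w" "X = zcls C w"
  using assms by (auto simp: zgroupoid_def)

lemma zigzag_single_obj: "a \<in> Obj C \<Longrightarrow> zigzag C [(a, True)]"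
  by (simp add: Obj_def)

lemma zeq_src:
  assumes "zigzag C w" shows "zeq C (w @ [(zsrc C w, True)]) w"
proof -
  obtain u f b where w: "w = u @ [(f, b)]"
    using zigzag_nonempty[OF assms] by (metis rev_exhaust surj_pair)
  have f: "f \<in> Mor C" using assms unfolding w by (cases "u = []") (auto simp: zigzag_append)
  have l: "zeq C [(f, b), (zsrc C w, True)] [(f, b)]"
    using f zeq.comp[of f C "Src C f"] zeq.inv_id[of f C]
    by (cases b) (auto simp: w zsrc_append zsrc_single src_mor rng_src comp_src)
  show ?thesis
  proof (cases "u = []")
    case False
    then have "zigzag C u" "zsrc C u = zrng C [(f, b)]"
      using assms unfolding w by (auto simp: zigzag_append)
    then have "zeq C (u @ [(f, b), (zsrc C w, True)]) (u @ [(f, b)])"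
      by (intro zeq.append zeq.refl l) (auto simp: zrng_def)
    then show ?thesis by (simp add: w)
  qed (use l w in simp)
qed

lemma zeq_rng:
  assumes "zigzag C w" shows "zeq C ((zrng C w, True) # w) w"
proof -
  obtain u f b where w: "w = (f, b) # u"
    using zigzag_nonempty[OF assms] by (metis list.exhaust surj_pair)
  have f: "f \<in> Mor C" using assms unfolding w by (simp add: zigzag_Cons)
  have l: "zeq C [(zrng C w, True), (f, b)] [(f, b)]"
    using f zeq.comp[of "Rng C f" C f] zeq.id_inv[of f C]
    by (cases b) (auto simp: w zrng_def lrng_def rng_mor src_rng rng_comp_id)
  show ?thesis
  proof (cases "u = []")
    case False
    then have "zigzag C u" "lsrc C (f, b) = zrng C u"
      using assms unfolding w by (auto simp: zigzag_Cons)
    then have "zeq C ([(zrng C w, True), (f, b)] @ u) ([(f, b)] @ u)"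
      by (intro zeq.append zeq.refl l) (auto simp: zsrc_def)
    then show ?thesis by (simp add: w)
  qed (use l w in simp)
qed

lemma zg_category: "category (zgroupoid C)"
proof
  fix X assume "X \<in> Mor (zgroupoid C)"
  then obtain w where w: "zigzag C w" "X = zcls C w" by (rule zg_mor_cases)
  then have o: "zsrc C w \<in> Obj C" "zrng C w \<in> Obj C" using zends_mor by auto
  then have o': "Src C (zsrc C w) = zsrc C w" "Rng C (zsrc C w) = zsrc C w"
    "Src C (zrng C w) = zrng C w" "Rng C (zrng C w) = zrng C w" by (auto simp: Obj_def)
  have om: "zsrc C w \<in> Mor C" "zrng C w \<in> Mor C" using o by (auto simp: Obj_def)
  note o'' = w om o' zg_src zg_rng zg_mor zsrc_single zrng_single
  show "Src (zgroupoid C) X \<in> Mor (zgroupoid C)" by (simp add: o'')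
  show "Rng (zgroupoid C) X \<in> Mor (zgroupoid C)" by (simp add: o'')
  show "Src (zgroupoid C) (Src (zgroupoid C) X) = Src (zgroupoid C) X" by (simp add: o'')
  show "Rng (zgroupoid C) (Src (zgroupoid C) X) = Src (zgroupoid C) X" by (simp add: o'')
  show "Src (zgroupoid C) (Rng (zgroupoid C) X) = Rng (zgroupoid C) X" by (simp add: o'')
  show "Rng (zgroupoid C) (Rng (zgroupoid C) X) = Rng (zgroupoid C) X" by (simp add: o'')
  show "Comp (zgroupoid C) X (Src (zgroupoid C) X) = X"
    using zeq_zcls[OF zeq_src[OF w(1)]] by (simp add: o'' zg_comp)
  show "Comp (zgroupoid C) (Rng (zgroupoid C) X) X = X"
    using zeq_zcls[OF zeq_rng[OF w(1)]] by (simp add: o'' zg_comp)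
  fix Y assume "Y \<in> Mor (zgroupoid C)" and XY: "Src (zgroupoid C) X = Rng (zgroupoid C) Y"
  then obtain v where v: "zigzag C v" "Y = zcls C v" by (auto elim: zg_mor_cases)
  have wv: "zsrc C w = zrng C v" using XY w v by (simp add: zg_composable)
  have ne: "w \<noteq> []" "v \<noteq> []" using w v zigzag_nonempty by auto
  have wvz: "zigzag C (w @ v)" using ne w v wv by (simp add: zigzag_append)
  show "Comp (zgroupoid C) X Y \<in> Mor (zgroupoid C)" by (simp add: w v wv wvz zg_comp zg_mor)
  show "Src (zgroupoid C) (Comp (zgroupoid C) X Y) = Src (zgroupoid C) Y"
    by (simp add: w v wv wvz zg_comp zg_src zsrc_append ne)
  show "Rng (zgroupoid C) (Comp (zgroupoid C) X Y) = Rng (zgroupoid C) X"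
    by (simp add: w v wv wvz zg_comp zg_rng zrng_append ne)
  fix Z assume "Z \<in> Mor (zgroupoid C)" and YZ: "Src (zgroupoid C) Y = Rng (zgroupoid C) Z"
  then obtain u where u: "zigzag C u" "Z = zcls C u" by (auto elim: zg_mor_cases)
  have vu: "zsrc C v = zrng C u" using YZ u v by (simp add: zg_composable)
  have "zigzag C (v @ u)"
    using ne zigzag_nonempty[OF u(1)] u v vu by (simp add: zigzag_append)
  then show "Comp (zgroupoid C) (Comp (zgroupoid C) X Y) Z =
      Comp (zgroupoid C) X (Comp (zgroupoid C) Y Z)"
    by (simp add: w v u wv vu wvz zg_comp zsrc_append zrng_append ne)
qed

definition zinv :: "('a \<times> bool) list \<Rightarrow> ('a \<times> bool) list" where
  "zinv w = rev (map (\<lambda>(f, b). (f, \<not> b)) w)"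

lemma zinv_ends: "w \<noteq> [] \<Longrightarrow> zsrc C (zinv w) = zrng C w \<and> zrng C (zinv w) = zsrc C w"
  by (auto simp: zinv_def zsrc_def zrng_def lsrc_def lrng_def last_rev hd_rev last_map hd_map
      split: prod.splits)

lemma zinv_zinv: "zinv (zinv w) = w"
  by (auto simp: zinv_def rev_map comp_def case_prod_beta)

lemma zinv_nonempty: "zinv w \<noteq> [] \<longleftrightarrow> w \<noteq> []"
  by (simp add: zinv_def)

lemma zigzag_zinv: "zigzag C w \<Longrightarrow> zigzag C (zinv w)"
proof (induction w)
  case (Cons l w)
  obtain f b where l: "l = (f, b)" by (cases l)
  have 1: "zinv (l # w) = zinv w @ [(f, \<not> b)]" by (simp add: l zinv_def)
  show ?case
  proof (cases "w = []")
    case True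
    with Cons.prems l show ?thesis by (simp add: zinv_def)
  next
    case False
    with Cons zinv_ends[OF False] show ?thesis
      unfolding 1 by (auto simp: l zigzag_append zigzag_Cons zinv_nonempty zrng_single lsrc_def)
  qed
qed simp

lemma zeq_zinv: "zigzag C w \<Longrightarrow> zeq C (w @ zinv w) [(zrng C w, True)]"
proof (induction w)
  case (Cons l w)
  obtain f b where l: "l = (f, b)" by (cases l)
  have f: "f \<in> Mor C" using Cons.prems l by (simp add: zigzag_Cons)
  have 0: "zeq C [(f, b), (f, \<not> b)] [(zrng C (l # w), True)]"
    using f zeq.left_inv zeq.right_inv by (cases b) (auto simp: l zrng_def lrng_def)
  show ?case
  proof (cases "w = []")
    case True
    with 0 l show ?thesis by (simp add: zinv_def)
  next
    case False
    then have w: "zigzag C w" "lsrc C l = zrng C w" using Cons.prems by (auto simp: zigzag_Cons)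
    have z1: "zigzag C [(f, b)]" "zigzag C [(f, \<not> b)]" using f by auto
    have s: "zsrc C [(f, b)] = zrng C w" "zrng C [(f, \<not> b)] = zrng C w"
      using w by (auto simp: l zsrc_def zrng_def lsrc_def lrng_def)
    have o: "Src C (zrng C w) = zrng C w" "Rng C (zrng C w) = zrng C w"
      using zends_mor[OF w(1)] by (auto simp: Obj_def)
    have a: "zeq C ((w @ zinv w) @ [(f, \<not> b)]) ([(zrng C w, True)] @ [(f, \<not> b)])"
      using zinv_ends[OF False] s
      by (intro zeq.append Cons.IH w zeq.refl z1) (simp add: zsrc_append zinv_nonempty False)
    have b: "zeq C ([(zrng C w, True)] @ [(f, \<not> b)]) [(f, \<not> b)]"
      using zeq_rng[OF z1(2)] s by simp
    have "zeq C ([(f, b)] @ ((w @ zinv w) @ [(f, \<not> b)])) ([(f, b)] @ [(f, \<not> b)])"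
      using s by (intro zeq.append zeq.refl z1 zeq.trans[OF a b]) (simp add: zrng_append False)
    from zeq.trans[OF this] 0 show ?thesis by (simp add: l zinv_def)
  qed
qed simp

lemma zg_groupoid: "groupoid (zgroupoid C)"
proof -
  interpret Z: category "zgroupoid C" by (rule zg_category)
  show ?thesis
  proof
    fix X assume "X \<in> Mor (zgroupoid C)"
    then obtain w where w: "zigzag C w" "X = zcls C w" by (rule zg_mor_cases)
    have ne: "w \<noteq> []" using w zigzag_nonempty by auto
    note z = zigzag_zinv[OF w(1)] and e = zinv_ends[OF ne]
    have "zeq C (zinv w @ w) [(zsrc C w, True)]" using zeq_zinv[OF z] e by (simp add: zinv_zinv)
    moreover note zeq_zinv[OF w(1)]
    ultimately have "zcls C (zinv w @ w) = zcls C [(zsrc C w, True)]"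
      "zcls C (w @ zinv w) = zcls C [(zrng C w, True)]"
      by (auto dest: zeq_zcls)
    then show "\<exists>Y \<in> Mor (zgroupoid C). Src (zgroupoid C) Y = Rng (zgroupoid C) X \<and>
        Rng (zgroupoid C) Y = Src (zgroupoid C) X \<and>
        Comp (zgroupoid C) X Y = Rng (zgroupoid C) X \<and>
        Comp (zgroupoid C) Y X = Src (zgroupoid C) X"
      using w z e by (intro bexI[of _ "zcls C (zinv w)"]) (auto simp: zg_src zg_rng zg_comp zg_mor)
  qed
qed

lemma zincl_functor: "is_functor C (zgroupoid C) (zincl C)"
proof -
  have "zincl C (Comp C f g) = Comp (zgroupoid C) (zincl C f) (zincl C g)"
    if "f \<in> Mor C" "g \<in> Mor C" "Src C f = Rng C g" for f g
    using that zeq_zcls[OF zeq.comp[OF that]]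
    by (simp add: zincl_def zg_comp zsrc_single zrng_single)
  then show ?thesis
    by (simp add: is_functor_def zg_mor zg_src zg_rng zincl_def zsrc_single zrng_single)
qed

lemma zincl_obj: "zincl C ` Obj C = Obj (zgroupoid C)"
proof
  show "zincl C ` Obj C \<subseteq> Obj (zgroupoid C)"
    using zincl_functor by (auto simp: is_functor_def Obj_def)
  show "Obj (zgroupoid C) \<subseteq> zincl C ` Obj C"
  proof
    fix X assume X: "X \<in> Obj (zgroupoid C)"
    then obtain w where w: "zigzag C w" "X = zcls C w" by (auto simp: Obj_def elim: zg_mor_cases)
    have "X = zincl C (zsrc C w)" using X w by (simp add: Obj_def zg_src zincl_def)
    then show "X \<in> zincl C ` Obj C" using zends_mor[OF w(1)] by blast
  qed
qed

end

text \<open>Evaluation of zigzags in a groupoid.\<close>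

definition leval :: "'g cat \<Rightarrow> ('a \<Rightarrow> 'g) \<Rightarrow> 'a \<times> bool \<Rightarrow> 'g" where
  "leval G F l = (if snd l then F (fst l) else ginv G (F (fst l)))"

fun zeval :: "'g cat \<Rightarrow> ('a \<Rightarrow> 'g) \<Rightarrow> ('a \<times> bool) list \<Rightarrow> 'g" where
  "zeval G F [] = undefined"
| "zeval G F [l] = leval G F l"
| "zeval G F (l # m # w) = Comp G (leval G F l) (zeval G F (m # w))"

lemma zeval_Cons: "w \<noteq> [] \<Longrightarrow> zeval G F (l # w) = Comp G (leval G F l) (zeval G F w)"
  by (cases w) auto

locale functor_to_groupoid = category C + G: groupoid G for C :: "'a cat" and G :: "'g cat" +
  fixes F :: "'a \<Rightarrow> 'g"
  assumes F: "is_functor C G F"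
begin

lemma F_simps:
  "f \<in> Mor C \<Longrightarrow> F f \<in> Mor G" "f \<in> Mor C \<Longrightarrow> F (Src C f) = Src G (F f)"
  "f \<in> Mor C \<Longrightarrow> F (Rng C f) = Rng G (F f)"
  "f \<in> Mor C \<Longrightarrow> g \<in> Mor C \<Longrightarrow> Src C f = Rng C g \<Longrightarrow> F (Comp C f g) = Comp G (F f) (F g)"
  using F by (auto simp: is_functor_def)

lemma leval: "fst l \<in> Mor C \<Longrightarrow> leval G F l \<in> Mor G \<and> Src G (leval G F l) = F (lsrc C l) \<and>
    Rng G (leval G F l) = F (lrng C l)"
  by (simp add: leval_def lsrc_def lrng_def F_simps G.ginv)

lemma zeval: "zigzag C w \<Longrightarrow> zeval G F w \<in> Mor G \<and> Src G (zeval G F w) = F (zsrc C w) \<and>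
    Rng G (zeval G F w) = F (zrng C w)"
proof (induction w)
  case (Cons l w)
  show ?case
  proof (cases "w = []")
    case True
    with Cons.prems leval[of l] show ?thesis by (simp add: zsrc_def zrng_def)
  next
    case False
    with Cons leval[of l] show ?thesis
      by (auto simp: zigzag_Cons zeval_Cons zsrc_def zrng_def G.comp_mor G.src_comp G.rng_comp)
  qed
qed simp

lemma zeval_append:
  "zigzag C u \<Longrightarrow> zigzag C v \<Longrightarrow> zsrc C u = zrng C v \<Longrightarrow>
    zeval G F (u @ v) = Comp G (zeval G F u) (zeval G F v)"
proof (induction u)
  case (Cons l u)
  note v = zigzag_nonempty[OF Cons.prems(2)]
  show ?case
  proof (cases "u = []")
    case False
    then have u: "zigzag C u" "lsrc C l = zrng C u" "fst l \<in> Mor C" "zsrc C u = zrng C v"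
      using Cons.prems by (auto simp: zigzag_Cons zsrc_def)
    have "Comp G (Comp G (leval G F l) (zeval G F u)) (zeval G F v) =
        Comp G (leval G F l) (Comp G (zeval G F u) (zeval G F v))"
      using u Cons.prems leval[of l] zeval[of u] zeval[of v] by (intro G.comp_assoc) auto
    then show ?thesis using False v u Cons by (simp add: zeval_Cons)
  qed (simp add: v zeval_Cons)
qed simp

lemma zeval_zeq: "zeq C u v \<Longrightarrow> zeval G F u = zeval G F v"
proof (induction rule: zeq.induct)
  case (append u u' v v')
  then show ?case using zeq_ends[OF append(1)] zeq_ends[OF append(2)] by (simp add: zeval_append)
next
  case (inv_id f)
  then show ?case using G.comp_src[OF G.ginv(1)[of "F f"]] by (simp add: leval_def F_simps G.ginv)
next
  case (id_inv f)
  then show ?case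
    using G.rng_comp_id[OF G.ginv(1)[of "F f"]] by (simp add: leval_def F_simps G.ginv)
qed (simp_all add: leval_def F_simps G.ginv)

lemma zeval_zrep: "zigzag C w \<Longrightarrow> zeval G F (zrep (zcls C w)) = zeval G F w"
  using zeval_zeq[OF zrep] by simp

lemma zeval_functor: "is_functor (zgroupoid C) G (\<lambda>X. zeval G F (zrep X))"
  unfolding is_functor_def
proof (intro conjI ballI impI)
  fix X assume "X \<in> Mor (zgroupoid C)"
  then obtain w where w: "zigzag C w" "X = zcls C w" by (rule zg_mor_cases)
  show "zeval G F (zrep X) \<in> Mor G" using w zeval by (simp add: zeval_zrep)
  show "zeval G F (zrep (Src (zgroupoid C) X)) = Src G (zeval G F (zrep X))"
    using w zeval zigzag_single_obj zends_mor
    by (simp add: zeval_zrep[OF zigzag_single_obj] zeval_zrep zg_src leval_def)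
  show "zeval G F (zrep (Rng (zgroupoid C) X)) = Rng G (zeval G F (zrep X))"
    using w zeval zigzag_single_obj zends_mor
    by (simp add: zeval_zrep[OF zigzag_single_obj] zeval_zrep zg_rng leval_def)
  fix Y assume "Y \<in> Mor (zgroupoid C)" and XY: "Src (zgroupoid C) X = Rng (zgroupoid C) Y"
  then obtain v where v: "zigzag C v" "Y = zcls C v" by (auto elim: zg_mor_cases)
  have wv: "zsrc C w = zrng C v" using XY w v by (simp add: zg_composable)
  have "zigzag C (w @ v)"
    using zigzag_nonempty[OF w(1)] zigzag_nonempty[OF v(1)] w v wv by (simp add: zigzag_append)
  then show "zeval G F (zrep (Comp (zgroupoid C) X Y)) =
      Comp G (zeval G F (zrep X)) (zeval G F (zrep Y))"
    using w v wv by (simp add: zg_comp zeval_zrep zeval_append)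
qed

lemma zeval_unique:
  assumes H: "is_functor (zgroupoid C) G H" and Hi: "\<And>x. x \<in> Mor C \<Longrightarrow> H (zincl C x) = F x"
  shows "zigzag C w \<Longrightarrow> H (zcls C w) = zeval G F w"
proof (induction w)
  case (Cons l w)
  have H_comp: "H (zcls C (u @ v)) = Comp G (H (zcls C u)) (H (zcls C v))"
    if "zigzag C u" "zigzag C v" "zsrc C u = zrng C v" for u v
    using that H by (simp add: zg_comp[symmetric] zg_composable zg_mor is_functor_def)
  have H_ends: "H (zcls C u) \<in> Mor G \<and> Src G (H (zcls C u)) = F (zsrc C u) \<and>
      Rng G (H (zcls C u)) = F (zrng C u)" if u: "zigzag C u" for u
  proof -
    have "zsrc C u \<in> Mor C" "zrng C u \<in> Mor C" using zends_mor[OF u] by (auto simp: Obj_def)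
    moreover have "H (Src (zgroupoid C) (zcls C u)) = Src G (H (zcls C u))"
      "H (Rng (zgroupoid C) (zcls C u)) = Rng G (H (zcls C u))" "H (zcls C u) \<in> Mor G"
      using H zg_mor[OF u] by (auto simp: is_functor_def)
    ultimately show ?thesis using u Hi by (simp add: zg_src zg_rng zincl_def[symmetric])
  qed
  obtain f b where l: "l = (f, b)" by (cases l)
  have f: "f \<in> Mor C" using Cons.prems l by (simp add: zigzag_Cons)
  have Hl: "H (zcls C [l]) = leval G F l"
  proof (cases b)
    case True
    with f Hi show ?thesis by (simp add: l leval_def zincl_def)
  next
    case False
    have "H (zcls C [(f, False)]) = ginv G (F f)"
    proof (rule G.inverse_unique[of "F f"])
      have "zcls C ([(f, False)] @ [(f, True)]) = zcls C [(Src C f, True)]"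
        using zeq_zcls[OF zeq.left_inv[OF f]] by simp
      then show "Comp G (H (zcls C [(f, False)])) (F f) = Src G (F f)"
        using H_comp[of "[(f, False)]" "[(f, True)]"] f Hi
        by (simp add: zsrc_single zrng_single zincl_def[symmetric] src_mor F_simps)
    qed (use f H_ends[of "[(f, False)]"] in
        \<open>auto simp: F_simps G.ginv zsrc_single zrng_single\<close>)
    with False show ?thesis by (simp add: l leval_def)
  qed
  show ?case
  proof (cases "w = []")
    case False
    then have w: "zigzag C w" "lsrc C l = zrng C w" using Cons.prems by (auto simp: zigzag_Cons)
    have "H (zcls C ([l] @ w)) = Comp G (H (zcls C [l])) (H (zcls C w))"
      using w f by (intro H_comp) (auto simp: l zsrc_def)
    then show ?thesis using Hl Cons.IH[OF w(1)] False by (simp add: zeval_Cons)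
  qed (use Hl in simp)
qed simp

end

context category
begin

lemma zgroupoid_universal: "universal_for TYPE('g) C (zgroupoid C) (zincl C)"
  unfolding universal_for_def
proof (intro allI impI)
  fix G :: "'g cat" and F assume GF: "groupoid G \<and> is_functor C G F"
  then interpret functor_to_groupoid C G F
    by (simp add: functor_to_groupoid_def functor_to_groupoid_axioms_def category_axioms)
  interpret Z: category "zgroupoid C" by (rule zg_category)
  show "\<exists>!H. H \<in> extensional (Mor (zgroupoid C)) \<and> is_functor (zgroupoid C) G H \<and>
      (\<forall>x \<in> Mor C. H (zincl C x) = F x)"
  proof (rule ex_ex1I)
    show "\<exists>H. H \<in> extensional (Mor (zgroupoid C)) \<and> is_functor (zgroupoid C) G H \<and>
        (\<forall>x \<in> Mor C. H (zincl C x) = F x)"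
      by (rule exI[of _ "restrict (\<lambda>X. zeval G F (zrep X)) (Mor (zgroupoid C))"])
        (auto intro: Z.is_functor_cong[OF zeval_functor] simp: zincl_def zeval_zrep zg_mor leval_def)
  next
    fix H K
    assume H: "H \<in> extensional (Mor (zgroupoid C)) \<and> is_functor (zgroupoid C) G H \<and>
        (\<forall>x \<in> Mor C. H (zincl C x) = F x)"
      and K: "K \<in> extensional (Mor (zgroupoid C)) \<and> is_functor (zgroupoid C) G K \<and>
        (\<forall>x \<in> Mor C. K (zincl C x) = F x)"
    show "H = K"
    proof (rule extensionalityI)
      fix X assume "X \<in> Mor (zgroupoid C)"
      then obtain w where "zigzag C w" "X = zcls C w" by (rule zg_mor_cases)
      then show "H X = K X" using H K by (simp add: zeval_unique)
    qed (use H K in auto)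
  qed
qed

theorem fundamental_groupoid_exists: "fundamental_groupoid C (zgroupoid C) (zincl C)"
  using zg_groupoid zincl_functor zincl_obj zgroupoid_universal
  by (simp add: fundamental_groupoid_def)

end

lemma universal_for_ex:
  fixes G :: "'g cat"
  assumes "universal_for TYPE('g) C P i" "groupoid G" "is_functor C G F"
  obtains H where "is_functor P G H" "\<And>x. x \<in> Mor C \<Longrightarrow> H (i x) = F x"
  using assms unfolding universal_for_def by blast

lemma universal_for_eq:
  fixes G :: "'g cat"
  assumes U: "universal_for TYPE('g) C P i" and G: "groupoid G" and P: "category P"
    and i: "is_functor C P i" and H: "is_functor P G H" and K: "is_functor P G K"
    and eq: "\<And>x. x \<in> Mor C \<Longrightarrow> H (i x) = K (i x)" and y: "y \<in> Mor P"
  shows "H y = K y"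
proof -
  let ?R = "\<lambda>H. restrict H (Mor P)"
  have im: "i x \<in> Mor P" if "x \<in> Mor C" for x using i that by (simp add: is_functor_def)
  have "is_functor P G (?R H)" "is_functor P G (?R K)"
    by (auto intro: category.is_functor_cong[OF P H] category.is_functor_cong[OF P K])
  moreover have "\<exists>!L. L \<in> extensional (Mor P) \<and> is_functor P G L \<and>
      (\<forall>x \<in> Mor C. L (i x) = H (i x))"
    using U[unfolded universal_for_def, rule_format, of G "\<lambda>x. H (i x)"] G is_functor_comp[OF i H]
    by simp
  then have "L = M"
    if "L \<in> extensional (Mor P)" "is_functor P G L" "\<And>x. x \<in> Mor C \<Longrightarrow> L (i x) = H (i x)"
      "M \<in> extensional (Mor P)" "is_functor P G M" "\<And>x. x \<in> Mor C \<Longrightarrow> M (i x) = H (i x)" for L M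
    using that by blast
  ultimately have "?R H = ?R K" using eq im by simp
  then show ?thesis using y by (metis restrict_apply')
qed

theorem fundamental_groupoid_universal:
  fixes C :: "'a cat" and P :: "'p cat"
  assumes C: "category C" and fg: "fundamental_groupoid C P i"
  shows "universal_for TYPE('g) C P i"
  unfolding universal_for_def
proof (intro allI impI)
  interpret category C by (rule C)
  let ?Z = "zgroupoid C" and ?j = "zincl C"
  have P: "groupoid P" and i: "is_functor C P i"
    and U: "universal_for TYPE('p) C P i" "universal_for TYPE(('a \<times> bool) list set) C P i"
    using fg by (auto simp: fundamental_groupoid_def)
  have Pc: "category P" using P by (simp add: groupoid_def)
  obtain A where A: "is_functor P ?Z A" "\<And>x. x \<in> Mor C \<Longrightarrow> A (i x) = ?j x"
    using universal_for_ex[OF U(2) zg_groupoid zincl_functor] by blast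
  obtain B where B: "is_functor ?Z P B" "\<And>x. x \<in> Mor C \<Longrightarrow> B (?j x) = i x"
    using universal_for_ex[OF zgroupoid_universal P i] by blast
  have id: "is_functor P P (\<lambda>y. y)" by (simp add: is_functor_def)
  have BA: "B (A y) = y" if "y \<in> Mor P" for y
    using universal_for_eq[OF U(1) P Pc i is_functor_comp[OF A(1) B(1)] id _ that] A B by simp
  fix G :: "'g cat" and F assume GF: "groupoid G \<and> is_functor C G F"
  then obtain E where E: "is_functor ?Z G E" "\<And>x. x \<in> Mor C \<Longrightarrow> E (?j x) = F x"
    using universal_for_ex[OF zgroupoid_universal, of G F] by blast
  have EA: "is_functor P G (\<lambda>y. E (A y))" by (rule is_functor_comp[OF A(1) E(1)])
  have im: "i x \<in> Mor P" if "x \<in> Mor C" for x using i that by (simp add: is_functor_def)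
  show "\<exists>!H. H \<in> extensional (Mor P) \<and> is_functor P G H \<and> (\<forall>x \<in> Mor C. H (i x) = F x)"
  proof (rule ex_ex1I)
    show "\<exists>H. H \<in> extensional (Mor P) \<and> is_functor P G H \<and> (\<forall>x \<in> Mor C. H (i x) = F x)"
      by (rule exI[of _ "restrict (\<lambda>y. E (A y)) (Mor P)"])
        (auto intro: category.is_functor_cong[OF Pc EA] simp: im A E)
  next
    have *: "H y = E (A y)"
      if "is_functor P G H" "\<forall>x \<in> Mor C. H (i x) = F x" "y \<in> Mor P" for H y
    proof -
      have "A y \<in> Mor ?Z" using A(1) that(3) by (simp add: is_functor_def)
      then have "H (B (A y)) = E (A y)"
        using universal_for_eq[OF zgroupoid_universal _ zg_category zincl_functor
            is_functor_comp[OF B(1) that(1)] E(1)] GF B E that(2) by simp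
      then show ?thesis using BA that(3) by simp
    qed
    fix H K
    assume "H \<in> extensional (Mor P) \<and> is_functor P G H \<and> (\<forall>x \<in> Mor C. H (i x) = F x)"
      "K \<in> extensional (Mor P) \<and> is_functor P G K \<and> (\<forall>x \<in> Mor C. K (i x) = F x)"
    then show "H = K" by (intro extensionalityI[of H "Mor P" K]) (auto simp: *)
  qed
qed

end

(* Record a path by its endpoints, its length and its edges: the path with edges e_0, ..., e_(n-1)
   is sent to the element (n, u) of the unrestricted wreath product of a free abelian group on the
   edges by the integers, where u maps the position k to the basis element e_k. Concatenation of
   paths becomes multiplication in the wreath product because the second factor is shifted by the
   length of the first. Paired with the endpoints this is a functor to a groupoid. It is injective,
   since a path is determined by its source and its sequence of edges, and it factors through i. *)

theory Submission
  imports Defs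
begin

text \<open>The pair groupoid on \<open>'a\<close> times a semidirect product in which
  \<open>n\<close> translates functions on the integers. No finiteness of support is imposed, so
  every tuple is a morphism.\<close>

definition wreath_groupoid :: "('a \<times> 'a \<times> int \<times> (int \<Rightarrow> 'a \<Rightarrow> int)) cat" where
  "wreath_groupoid = \<lparr>Mor = UNIV,
     Src = (\<lambda>(r, s, n, u). (s, s, 0, \<lambda>k e. 0)),
     Rng = (\<lambda>(r, s, n, u). (r, r, 0, \<lambda>k e. 0)),
     Comp = (\<lambda>(r, s, n, u) (r', s', m, v). (r, s', n + m, \<lambda>k e. u k e + v (k - n) e))\<rparr>"

lemma groupoid_wreath: "groupoid wreath_groupoid"
proof
  fix f :: "'a \<times> 'a \<times> int \<times> (int \<Rightarrow> 'a \<Rightarrow> int)"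
  obtain r s n u where f: "f = (r, s, n, u)" by (cases f) auto
  show "\<exists>g \<in> Mor wreath_groupoid. Src wreath_groupoid g = Rng wreath_groupoid f \<and>
      Rng wreath_groupoid g = Src wreath_groupoid f \<and>
      Comp wreath_groupoid f g = Rng wreath_groupoid f \<and>
      Comp wreath_groupoid g f = Src wreath_groupoid f"
    \<comment> \<open>The last component \<open>v\<close> of an inverse must satisfy
      \<open>u k + v (k - n) = 0\<close>; replace \<open>k\<close> by \<open>k + n\<close>.\<close>
    by (rule bexI[of _ "(s, r, - n, \<lambda>k e. - u (k + n) e)"]) (simp_all add: wreath_groupoid_def f)
qed (auto simp: wreath_groupoid_def algebra_simps)

context one_graph
begin

lemma factorisation_ex:
  assumes "f \<in> Mor \<Lambda>" "d f = m + n"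
  obtains \<mu> \<nu> where "\<mu> \<in> Mor \<Lambda>" "\<nu> \<in> Mor \<Lambda>" "d \<mu> = m" "d \<nu> = n" "Src \<Lambda> \<mu> = Rng \<Lambda> \<nu>"
    "f = Comp \<Lambda> \<mu> \<nu>"
  using factorisation[OF assms] by blast

text \<open>Additivity of \<open>d\<close> makes the second factors agree in degree too, so both
  pairs factor one morphism with the same degree split.\<close>

lemma factorisation_unique:
  assumes "\<mu> \<in> Mor \<Lambda>" "\<nu> \<in> Mor \<Lambda>" "Src \<Lambda> \<mu> = Rng \<Lambda> \<nu>"
    and "\<mu>' \<in> Mor \<Lambda>" "\<nu>' \<in> Mor \<Lambda>" "Src \<Lambda> \<mu>' = Rng \<Lambda> \<nu>'"
    and "Comp \<Lambda> \<mu> \<nu> = Comp \<Lambda> \<mu>' \<nu>'" "d \<mu> = d \<mu>'"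
  shows "\<mu> = \<mu>' \<and> \<nu> = \<nu>'"
proof -
  have d_eq: "d \<nu> = d \<nu>'" using assms degree_comp[of \<mu> \<nu>] degree_comp[of \<mu>' \<nu>'] by simp
  have "Comp \<Lambda> \<mu> \<nu> \<in> Mor \<Lambda>" "d (Comp \<Lambda> \<mu> \<nu>) = d \<mu> + d \<nu>"
    using comp_mor[OF assms(1-3)] degree_comp[OF assms(1-3)] .
  then have "\<exists>\<^sub>\<le>\<^sub>1(\<alpha>, \<beta>). \<alpha> \<in> Mor \<Lambda> \<and> \<beta> \<in> Mor \<Lambda> \<and> d \<alpha> = d \<mu> \<and> d \<beta> = d \<nu> \<and>
      Src \<Lambda> \<alpha> = Rng \<Lambda> \<beta> \<and> Comp \<Lambda> \<mu> \<nu> = Comp \<Lambda> \<alpha> \<beta>"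
    using factorisation[of "Comp \<Lambda> \<mu> \<nu>" "d \<mu>" "d \<nu>"] by (simp only: ex1_iff_ex_Uniq)
  then have "(\<mu>, \<nu>) = (\<mu>', \<nu>')"
    by (rule Uniq_D) (simp_all only: prod.case assms d_eq simp_thms)
  then show ?thesis by simp
qed

lemma degree_src: "f \<in> Mor \<Lambda> \<Longrightarrow> d (Src \<Lambda> f) = 0"
  and degree_rng: "f \<in> Mor \<Lambda> \<Longrightarrow> d (Rng \<Lambda> f) = 0"
  by (simp_all add: degree_obj obj_src obj_rng)

text \<open>Composing \<open>f\<close> with its source or with its range gives two factorisations of
  \<open>f\<close> for the split 0 + 0; uniqueness identifies them.\<close>

lemma degree_0_eq_src:
  assumes "f \<in> Mor \<Lambda>" "d f = 0"
  shows "f = Src \<Lambda> f"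
  using factorisation_unique[of f "Src \<Lambda> f" "Rng \<Lambda> f" f] assms
  by (simp add: src_mor rng_mor rng_src src_rng comp_src rng_comp_id degree_rng)

text \<open>Positions start at 0 at the range end. Being a relation, it needs no default edge for
  positions past the end.\<close>

definition edge_at :: "nat \<Rightarrow> 'a \<Rightarrow> 'a \<Rightarrow> bool" where
  "edge_at k f e \<longleftrightarrow> e \<in> Mor \<Lambda> \<and> d e = 1 \<and>
     (\<exists>\<mu> \<in> Mor \<Lambda>. \<exists>\<nu> \<in> Mor \<Lambda>. Src \<Lambda> \<mu> = Rng \<Lambda> e \<and> Src \<Lambda> e = Rng \<Lambda> \<nu> \<and> d \<mu> = k \<and>
        f = Comp \<Lambda> \<mu> (Comp \<Lambda> e \<nu>))"

lemma edge_at_less: "edge_at k f e \<Longrightarrow> k < d f"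
  by (auto simp: edge_at_def degree_comp comp_mor rng_comp)

text \<open>Unique factorisation applies twice: first to the prefix of degree \<open>k\<close>, then
  to the leading edge of the remainder.\<close>

lemma edge_at_unique:
  assumes "edge_at k f e" "edge_at k f e'"
  shows "e = e'"
proof -
  obtain \<mu> \<nu> where 1: "\<mu> \<in> Mor \<Lambda>" "\<nu> \<in> Mor \<Lambda>" "e \<in> Mor \<Lambda>" "d e = 1" "Src \<Lambda> \<mu> = Rng \<Lambda> e"
      "Src \<Lambda> e = Rng \<Lambda> \<nu>" "d \<mu> = k" "f = Comp \<Lambda> \<mu> (Comp \<Lambda> e \<nu>)"
    using assms(1) by (auto simp: edge_at_def)
  obtain \<mu>' \<nu>' where 2: "\<mu>' \<in> Mor \<Lambda>" "\<nu>' \<in> Mor \<Lambda>" "e' \<in> Mor \<Lambda>" "d e' = 1" "Src \<Lambda> \<mu>' = Rng \<Lambda> e'"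
      "Src \<Lambda> e' = Rng \<Lambda> \<nu>'" "d \<mu>' = k" "f = Comp \<Lambda> \<mu>' (Comp \<Lambda> e' \<nu>')"
    using assms(2) by (auto simp: edge_at_def)
  have "Comp \<Lambda> e \<nu> = Comp \<Lambda> e' \<nu>'"
    using factorisation_unique[of \<mu> "Comp \<Lambda> e \<nu>" \<mu>' "Comp \<Lambda> e' \<nu>'"] 1 2
    by (simp add: comp_mor rng_comp)
  then show ?thesis using factorisation_unique[of e \<nu> e' \<nu>'] 1 2 by simp
qed

lemma edge_at_ex:
  assumes "f \<in> Mor \<Lambda>" "k < d f"
  shows "\<exists>e. edge_at k f e"
proof -
  \<comment> \<open>Cut \<open>f\<close> into degrees \<open>k\<close>, 1 and the rest;
    \<open>k < d f\<close> makes the truncated subtraction exact.\<close>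
  have "d f = k + (1 + (d f - k - 1))" using assms(2) by simp
  then obtain \<mu> \<rho> where 1: "\<mu> \<in> Mor \<Lambda>" "\<rho> \<in> Mor \<Lambda>" "d \<mu> = k" "d \<rho> = 1 + (d f - k - 1)"
      "Src \<Lambda> \<mu> = Rng \<Lambda> \<rho>" "f = Comp \<Lambda> \<mu> \<rho>"
    using factorisation_ex[OF assms(1)] by metis
  obtain e \<nu> where 2: "e \<in> Mor \<Lambda>" "\<nu> \<in> Mor \<Lambda>" "d e = 1" "Src \<Lambda> e = Rng \<Lambda> \<nu>" "\<rho> = Comp \<Lambda> e \<nu>"
    using factorisation_ex[OF 1(2,4)] by metis
  have "edge_at k f e"
    using 1 2 rng_comp[of e \<nu>] unfolding edge_at_def by metis
  then show ?thesis ..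
qed

lemma edge_at_comp_left:
  assumes f: "edge_at k f e" and g: "g \<in> Mor \<Lambda>" "Src \<Lambda> f = Rng \<Lambda> g"
  shows "edge_at k (Comp \<Lambda> f g) e"
proof -
  obtain \<mu> \<nu> where 1: "\<mu> \<in> Mor \<Lambda>" "\<nu> \<in> Mor \<Lambda>" "e \<in> Mor \<Lambda>" "d e = 1" "Src \<Lambda> \<mu> = Rng \<Lambda> e"
      "Src \<Lambda> e = Rng \<Lambda> \<nu>" "d \<mu> = k" "f = Comp \<Lambda> \<mu> (Comp \<Lambda> e \<nu>)"
    using f by (auto simp: edge_at_def)
  then have \<nu>: "Src \<Lambda> \<nu> = Rng \<Lambda> g" using g by (simp add: comp_mor src_comp rng_comp)
  then have "Comp \<Lambda> f g = Comp \<Lambda> \<mu> (Comp \<Lambda> e (Comp \<Lambda> \<nu> g))"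
    using 1 g by (simp add: comp_assoc comp_mor src_comp rng_comp)
  moreover have "Comp \<Lambda> \<nu> g \<in> Mor \<Lambda>" "Src \<Lambda> e = Rng \<Lambda> (Comp \<Lambda> \<nu> g)"
    using 1 g \<nu> by (simp_all add: comp_mor rng_comp)
  ultimately show ?thesis using 1 unfolding edge_at_def by blast
qed

lemma edge_at_comp_right:
  assumes g: "edge_at k g e" and f: "f \<in> Mor \<Lambda>" "Src \<Lambda> f = Rng \<Lambda> g"
  shows "edge_at (d f + k) (Comp \<Lambda> f g) e"
proof -
  obtain \<mu> \<nu> where 1: "\<mu> \<in> Mor \<Lambda>" "\<nu> \<in> Mor \<Lambda>" "e \<in> Mor \<Lambda>" "d e = 1" "Src \<Lambda> \<mu> = Rng \<Lambda> e"
      "Src \<Lambda> e = Rng \<Lambda> \<nu>" "d \<mu> = k" "g = Comp \<Lambda> \<mu> (Comp \<Lambda> e \<nu>)"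
    using g by (auto simp: edge_at_def)
  then have \<mu>: "Src \<Lambda> f = Rng \<Lambda> \<mu>" using f by (simp add: comp_mor rng_comp)
  then have "Comp \<Lambda> f g = Comp \<Lambda> (Comp \<Lambda> f \<mu>) (Comp \<Lambda> e \<nu>)"
    using 1 f by (simp add: comp_assoc comp_mor rng_comp)
  moreover have "Comp \<Lambda> f \<mu> \<in> Mor \<Lambda>" "Src \<Lambda> (Comp \<Lambda> f \<mu>) = Rng \<Lambda> e" "d (Comp \<Lambda> f \<mu>) = d f + k"
    using 1 f \<mu> by (simp_all add: comp_mor src_comp degree_comp)
  ultimately show ?thesis using 1 unfolding edge_at_def by blast
qed

text \<open>From right to left, lengthen the tail or the prefix. Conversely, degree guarantees some
  edge at that position of the factor; carried over to the composite it must be \<open>e\<close> by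
  uniqueness.\<close>

lemma edge_at_comp:
  assumes "f \<in> Mor \<Lambda>" "g \<in> Mor \<Lambda>" "Src \<Lambda> f = Rng \<Lambda> g"
  shows "edge_at k (Comp \<Lambda> f g) e \<longleftrightarrow>
    (if k < d f then edge_at k f e else edge_at (k - d f) g e)"
proof (cases "k < d f")
  case True
  then show ?thesis
    using edge_at_ex[OF assms(1)] edge_at_comp_left[OF _ assms(2,3)] edge_at_unique by metis
next
  case False
  have "edge_at k (Comp \<Lambda> f g) e'" if "edge_at (k - d f) g e'" for e'
    using edge_at_comp_right[OF that assms(1,3)] False by simp
  moreover have "\<exists>e'. edge_at (k - d f) g e'" if "edge_at k (Comp \<Lambda> f g) e"
    using edge_at_less[OF that] False assms by (intro edge_at_ex) (simp_all add: degree_comp)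
  ultimately show ?thesis using False edge_at_unique by metis
qed

text \<open>The guard \<open>0 \<le> k\<close> is essential, since \<open>nat\<close> sends negative
  integers to 0.\<close>

definition edge_sequence :: "'a \<Rightarrow> int \<Rightarrow> 'a \<Rightarrow> int" where
  "edge_sequence f k e = of_bool (0 \<le> k \<and> edge_at (nat k) f e)"

lemma edge_sequence_degree_0: "d f = 0 \<Longrightarrow> edge_sequence f = (\<lambda>k e. 0)"
  by (auto simp: edge_sequence_def fun_eq_iff dest: edge_at_less)

text \<open>At most one summand is nonzero: below \<open>d f\<close> the second vanishes by its
  guard, from \<open>d f\<close> on the first by \<open>edge_at_less\<close>.\<close>

lemma edge_sequence_comp:
  assumes "f \<in> Mor \<Lambda>" "g \<in> Mor \<Lambda>" "Src \<Lambda> f = Rng \<Lambda> g"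
  shows "edge_sequence (Comp \<Lambda> f g) k e = edge_sequence f k e + edge_sequence g (k - int (d f)) e"
proof (cases "k < int (d f)")
  case True
  then show ?thesis by (auto simp: edge_sequence_def edge_at_comp[OF assms])
next
  case False
  then show ?thesis
    by (auto simp: edge_sequence_def edge_at_comp[OF assms] nat_diff_distrib dest: edge_at_less)
qed

definition path_code :: "'a \<Rightarrow> 'a \<times> 'a \<times> int \<times> (int \<Rightarrow> 'a \<Rightarrow> int)" where
  "path_code f = (Rng \<Lambda> f, Src \<Lambda> f, int (d f), edge_sequence f)"

lemma path_code_functor: "is_functor \<Lambda> wreath_groupoid path_code"
  by (simp add: is_functor_def path_code_def wreath_groupoid_def src_src rng_src src_rng rng_rng
      degree_src degree_rng edge_sequence_degree_0 src_comp rng_comp degree_comp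
      edge_sequence_comp fun_eq_iff)

text \<open>Induction on the degree, removing the edge at the range end, which keeps the source.
  Equality of sources settles degree 0, where there are no edges to compare.\<close>

lemma eq_if_edges_eq:
  assumes "f \<in> Mor \<Lambda>" "g \<in> Mor \<Lambda>" "Src \<Lambda> f = Src \<Lambda> g" "d f = d g"
    and "\<And>k e. edge_at k f e \<longleftrightarrow> edge_at k g e"
  shows "f = g"
  using assms
proof (induction "d f" arbitrary: f g)
  case 0
  then show ?case using degree_0_eq_src[of f] degree_0_eq_src[of g] by simp
next
  case (Suc n)
  obtain a f' where f: "a \<in> Mor \<Lambda>" "f' \<in> Mor \<Lambda>" "d a = 1" "d f' = n" "Src \<Lambda> a = Rng \<Lambda> f'"
      "f = Comp \<Lambda> a f'"
    using factorisation_ex[of f 1 n] Suc.prems Suc.hyps(2) by auto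
  obtain b g' where g: "b \<in> Mor \<Lambda>" "g' \<in> Mor \<Lambda>" "d b = 1" "d g' = n" "Src \<Lambda> b = Rng \<Lambda> g'"
      "g = Comp \<Lambda> b g'"
    using factorisation_ex[of g 1 n] Suc.prems Suc.hyps(2) by auto
  \<comment> \<open>The prefix of degree 0 is the identity \<open>Rng \<Lambda> c\<close>.\<close>
  have first: "edge_at 0 (Comp \<Lambda> c h) c"
    if "c \<in> Mor \<Lambda>" "h \<in> Mor \<Lambda>" "d c = 1" "Src \<Lambda> c = Rng \<Lambda> h" for c h
  proof -
    have "Comp \<Lambda> c h = Comp \<Lambda> (Rng \<Lambda> c) (Comp \<Lambda> c h)"
      using rng_comp_id[of "Comp \<Lambda> c h"] that by (simp add: comp_mor rng_comp)
    moreover have "Src \<Lambda> (Rng \<Lambda> c) = Rng \<Lambda> c" "d (Rng \<Lambda> c) = 0" "Rng \<Lambda> c \<in> Mor \<Lambda>"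
      using that by (simp_all add: src_rng degree_rng rng_mor)
    ultimately show ?thesis using that unfolding edge_at_def by blast
  qed
  have "a = b" using first[of a f'] first[of b g'] f g Suc.prems(5) edge_at_unique by metis
  moreover have "f' = g'"
  proof (rule Suc.hyps(1))
    \<comment> \<open>Removing one edge lowers all later positions by one.\<close>
    show "edge_at k f' e \<longleftrightarrow> edge_at k g' e" for k e
      using Suc.prems(5)[of "Suc k" e] f g by (simp add: edge_at_comp)
  qed (use f g Suc.prems in \<open>simp_all add: src_comp\<close>)
  ultimately show ?case using f g by simp
qed

lemma inj_path_code: "inj_on path_code (Mor \<Lambda>)"
proof (rule inj_onI)
  fix f g assume fg: "f \<in> Mor \<Lambda>" "g \<in> Mor \<Lambda>" "path_code f = path_code g"
  have "edge_at k h e \<longleftrightarrow> edge_sequence h (int k) e = 1" for k h e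
    by (simp add: edge_sequence_def)
  then have "edge_at k f e \<longleftrightarrow> edge_at k g e" for k e
    using fg(3) by (simp add: path_code_def)
  moreover have "Src \<Lambda> f = Src \<Lambda> g" "d f = d g"
    using fg(3) by (simp_all add: path_code_def)
  ultimately show "f = g" using eq_if_edges_eq fg(1,2) by blast
qed

end

theorem theorem3p14:
  fixes \<Lambda> :: "'a cat" and d :: "'a \<Rightarrow> nat" and P :: "'p cat" and i :: "'a \<Rightarrow> 'p"
  assumes "one_graph \<Lambda> d"
    and "fundamental_groupoid \<Lambda> P i"
  shows "inj_on i (Mor \<Lambda>)"
proof -
  interpret one_graph \<Lambda> d by (rule assms(1))
  \<comment> \<open>Universality is needed at the type of \<open>wreath_groupoid\<close>, hence its
    extension to all types. As \<open>H\<close> after \<open>i\<close> is the injective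
    \<open>path_code\<close>, \<open>i\<close> is injective.\<close>
  obtain H where "\<And>x. x \<in> Mor \<Lambda> \<Longrightarrow> H (i x) = path_code x"
    using universal_for_ex[OF fundamental_groupoid_universal[OF category_axioms assms(2)]
        groupoid_wreath path_code_functor] by blast
  then show ?thesis using inj_path_code by (metis inj_on_def)
qed

end
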